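(* Let $G$ be a finite group, let $\pi$ be a set of primes and let $p$ be the smallest prime in $\pi$. If $x \in G_{\pi}\setminus O_{\pi}(G)$, then $$\frac{|C_{G}(x)_{\pi}|}{|G_{\pi}|} \leq \frac{1}{p}.$$
   Context: For a finite group $H$ and a set of primes $\pi$, a $\pi$-element of $H$ is an element all of whose order's prime divisors lie in $\pi$ (the identity is a $\pi$-element). $H_{\pi}$ denotes the set of all $\pi$-elements of $H$; in particular $C_G(x)_\pi$ is the set of $\pi$-elements of the centralizer $C_G(x)$. $O_{\pi}(G)$ is the largest normal $\pi$-subgroup of $G$. *)

theory Defs
  imports "HOL-Algebra.Algebra" "HOL-Computational_Algebra.Primes"
begin

hide_const (open) Divisibility.prime

definition pi_number :: "nat set \<Rightarrow> nat \<Rightarrow> bool" where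
  "pi_number \<pi> n \<longleftrightarrow> (\<forall>q. prime q \<longrightarrow> q dvd n \<longrightarrow> q \<in> \<pi>)"

definition pi_elements :: "('a, 'b) monoid_scheme \<Rightarrow> nat set \<Rightarrow> 'a set" where
  "pi_elements H \<pi> = {h \<in> carrier H. pi_number \<pi> (group.ord H h)}"

definition centralizer :: "('a, 'b) monoid_scheme \<Rightarrow> 'a \<Rightarrow> 'a set" where
  "centralizer G x = {g \<in> carrier G. g \<otimes>\<^bsub>G\<^esub> x = x \<otimes>\<^bsub>G\<^esub> g}"

definition pi_subgroup :: "'a set \<Rightarrow> nat set \<Rightarrow> ('a, 'b) monoid_scheme \<Rightarrow> bool" where
  "pi_subgroup N \<pi> G \<longleftrightarrow> subgroup N G \<and> pi_number \<pi> (card N)"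

text \<open>\<^const>\<open>Greatest\<close> is taken with respect to inclusion; the greatest element exists
  in a finite group by \<open>pi_core_greatest\<close> below.\<close>

definition pi_core :: "nat set \<Rightarrow> ('a, 'b) monoid_scheme \<Rightarrow> 'a set" where
  "pi_core \<pi> G = (GREATEST N. N \<lhd> G \<and> pi_subgroup N \<pi> G)"

lemma (in group) centralizer_subgroup:
  assumes "x \<in> carrier G"
  shows "subgroup (centralizer G x) G"
proof (rule subgroupI)
  show "centralizer G x \<subseteq> carrier G" by (auto simp: centralizer_def)
  show "centralizer G x \<noteq> {}" using assms by (auto simp: centralizer_def)
next
  fix a assume "a \<in> centralizer G x"
  then show "inv a \<in> centralizer G x"
    using assms unfolding centralizer_def mem_Collect_eq
    by (metis inv_closed inv_solve_left inv_solve_right' m_assoc m_closed)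
next
  fix a b assume "a \<in> centralizer G x" "b \<in> centralizer G x"
  then show "a \<otimes> b \<in> centralizer G x"
    using assms unfolding centralizer_def mem_Collect_eq by (metis m_assoc m_closed)
qed

lemma pi_number_mult: "pi_number \<pi> a \<Longrightarrow> pi_number \<pi> b \<Longrightarrow> pi_number \<pi> (a * b)"
  unfolding pi_number_def by (metis prime_dvd_mult_iff)

lemma pi_number_dvd: "pi_number \<pi> b \<Longrightarrow> a dvd b \<Longrightarrow> pi_number \<pi> a"
  unfolding pi_number_def by (meson dvd_trans)

lemma (in group) card_set_mult_dvd:
  assumes "H \<lhd> G" "subgroup S G" "finite (carrier G)"
  shows "card (H <#> S) dvd card H * card S"
proof -
  interpret second_isomorphism_grp H G S
    using assms by (simp add: second_isomorphism_grp_def second_isomorphism_grp_axioms_def)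
  let ?HS = "G\<lparr>carrier := H <#> S\<rparr>" and ?S = "G\<lparr>carrier := S\<rparr>"
  have gHS: "group ?HS" using normal_set_mult_subgroup subgroup_imp_group by blast
  have gS: "group ?S" using assms(2) subgroup_imp_group by blast
  have sub: "subgroup H ?HS"
    using H_contained_in_set_mult normal_set_mult_subgroup is_subgroup subgroup_incl by blast
  have n: "S \<inter> H \<lhd> ?S" by (rule normal_subgrp_intersection_normal)
  have "card (carrier (?S Mod (H \<inter> S))) = card (carrier (?HS Mod H))"
    using normal_intersection_quotient_isom iso_same_card is_isoI by blast
  moreover have "card (carrier (?S Mod (H \<inter> S))) * card (H \<inter> S) = card S"
    using group.lagrange[OF gS normal_imp_subgroup[OF n]]
    by (simp add: FactGroup_def order_def Int_commute)
  moreover have "card (carrier (?HS Mod H)) * card H = card (H <#> S)"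
    using group.lagrange[OF gHS sub] by (simp add: FactGroup_def order_def)
  ultimately show ?thesis
    by (metis dvd_triv_left mult.commute mult_dvd_mono dvd_refl)
qed

lemma (in group) pi_core_greatest:
  assumes "finite (carrier G)"
  shows "pi_core \<pi> G \<lhd> G" "pi_subgroup (pi_core \<pi> G) \<pi> G"
    and "\<And>N. N \<lhd> G \<Longrightarrow> pi_subgroup N \<pi> G \<Longrightarrow> N \<subseteq> pi_core \<pi> G"
proof -
  define P where "P N \<longleftrightarrow> N \<lhd> G \<and> pi_subgroup N \<pi> G" for N
  have one: "P {\<one>}"
    by (auto simp: P_def pi_subgroup_def pi_number_def one_is_normal triv_subgroup)
  have sub: "N \<subseteq> carrier G" if "P N" for N
    using that by (auto simp: P_def pi_subgroup_def dest: subgroup.mem_carrier)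
  have "\<forall>N. P N \<longrightarrow> card N < Suc (card (carrier G))"
    using sub assms by (simp add: card_mono less_Suc_eq_le)
  then obtain N where N: "P N" and max: "\<And>M. P M \<Longrightarrow> card M \<le> card N"
    using ex_has_greatest_nat[of P "{\<one>}" card "Suc (card (carrier G))"] one
    by (metis less_imp_le)
  have *: "M \<subseteq> N" if M: "P M" for M
  proof -
    have nN: "N \<lhd> G" and nM: "M \<lhd> G" and sM: "subgroup M G"
      using N M by (auto simp: P_def normal_imp_subgroup)
    interpret second_isomorphism_grp N G M
      using nN sM by (simp add: second_isomorphism_grp_def second_isomorphism_grp_axioms_def)
    have "pi_number \<pi> (card (N <#> M))"
      using N M card_set_mult_dvd[OF nN sM assms] pi_number_mult pi_number_dvd
      unfolding P_def pi_subgroup_def by metis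
    then have PNM: "P (N <#> M)"
      using normal_subgroup_set_mult_closed[OF nN nM]
      by (simp add: P_def pi_subgroup_def normal_imp_subgroup)
    have "finite (N <#> M)" using sub[OF PNM] assms finite_subset by blast
    then have "N = N <#> M"
      using card_seteq H_contained_in_set_mult max[OF PNM] by blast
    then show ?thesis using S_contained_in_set_mult by blast
  qed
  have eq: "pi_core \<pi> G = N"
    unfolding pi_core_def P_def[symmetric] by (rule Greatest_equality) (use N * in auto)
  show "pi_core \<pi> G \<lhd> G" "pi_subgroup (pi_core \<pi> G) \<pi> G"
    using N eq by (auto simp: P_def)
  show "\<And>M. M \<lhd> G \<Longrightarrow> pi_subgroup M \<pi> G \<Longrightarrow> M \<subseteq> pi_core \<pi> G"
    using * eq by (auto simp: P_def)
qed

end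

(* The element x has a power y of prime power order, for a prime q in \<pi>, that lies outside
O_\<pi>(G), hence outside O_q(G); as C(x) is contained in C(y), it suffices to bound C(y), and
q >= p. Choose a subgroup K minimal subject to containing a conjugate of y outside O_q(K). As in
the Alperin-Lyons proof of the Baer-Suzuki theorem, the conjugates of y in K outside O_q(K) fall
into disjoint blocks (the maximal subsets generating q-groups), elements of different blocks
generate K, and such an element normalizes no block but its own. So for a in one block and b in
another, a and the conjugates of b by 1, a, ..., a^(q-1) are q + 1 conjugates of y that pairwise
generate K. The sets of \<pi>-elements of their centralizers have a common size n and pairwise
intersect in D, the set of \<pi>-elements centralizing K. Since the sets a^i D with i < q are
disjoint inside C(a), q |D| <= n, and so |G_\<pi>| >= (q + 1)(n - |D|) + |D| >= q n. *)

theory Submission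
  imports Defs
begin

section \<open>Actions given by explicit maps, and orbit counting for groups of prime power
  order\<close>

context group
begin

text \<open>The map of \<open>inv g\<close> inverts that of \<open>g\<close>, so bijectivity follows
  from closure and the action laws. \<open>restrict\<close> appears because the elements of
  \<open>Bij S\<close> are extensional functions.\<close>

lemma action_by_closed_map:
  assumes "\<And>g s. g \<in> carrier G \<Longrightarrow> s \<in> S \<Longrightarrow> act g s \<in> S"
    and "\<And>s. s \<in> S \<Longrightarrow> act \<one> s = s"
    and "\<And>g h s. \<lbrakk>g \<in> carrier G; h \<in> carrier G; s \<in> S\<rbrakk> \<Longrightarrow> act (g \<otimes> h) s = act g (act h s)"
  shows "group_action G S (\<lambda>g. restrict (act g) S)"
proof -
  have bij: "restrict (act g) S \<in> Bij S" if g: "g \<in> carrier G" for g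
  proof -
    have "bij_betw (act g) S S"
    proof (rule bij_betw_byWitness[of _ "act (inv g)"])
      show "\<forall>s\<in>S. act (inv g) (act g s) = s" "\<forall>s\<in>S. act g (act (inv g) s) = s"
        using assms g by (metis inv_closed l_inv, metis inv_closed r_inv)
    qed (use assms(1) g in auto)
    then show ?thesis
      by (simp add: Bij_def)
  qed
  show ?thesis
  proof (intro group_action.intro group_hom.intro group_hom_axioms.intro homI)
    fix g h assume gh: "g \<in> carrier G" "h \<in> carrier G"
    then show "restrict (act (g \<otimes> h)) S
        = restrict (act g) S \<otimes>\<^bsub>BijGroup S\<^esub> restrict (act h) S"
      using bij assms by (auto simp: BijGroup_def compose_def fun_eq_iff restrict_def)
  next
    show "restrict (act g) S \<in> carrier (BijGroup S)" if "g \<in> carrier G" for g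
      using bij[OF that] by (simp add: BijGroup_def)
  qed (simp_all add: is_group group_BijGroup)
qed

lemma pi_subgroup_subset:
  assumes "pi_subgroup Q \<pi> G" "subgroup H G" "H \<subseteq> Q" "finite (carrier G)"
  shows "pi_subgroup H \<pi> G"
proof -
  have Q: "subgroup Q G" "pi_number \<pi> (card Q)"
    using assms by (auto simp: pi_subgroup_def)
  have "subgroup H (G\<lparr>carrier := Q\<rparr>)"
    by (rule subgroup_incl[OF assms(2) Q(1) assms(3)])
  then have "card (rcosets\<^bsub>G\<lparr>carrier := Q\<rparr>\<^esub> H) * card H = card Q"
    using group.lagrange[OF subgroup_imp_group[OF Q(1)]] by (simp add: order_def)
  then have "card H dvd card Q"
    by (metis dvd_triv_right)
  then show ?thesis
    using Q assms(2) pi_number_dvd by (auto simp: pi_subgroup_def)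
qed

end

lemma pi_number_singleton_dvd:
  assumes "pi_number {q} n" "d dvd n" "d \<noteq> 1"
  shows "q dvd d"
  using assms by (metis pi_number_def pi_number_dvd prime_factor_nat singletonD)

text \<open>The moved points form a union of orbits with more than one point each, and an orbit size
  divides the group order, whose only possible prime divisor is \<open>q\<close>. This is the
  congruence modulo \<open>q\<close> between a set and its fixed points.\<close>

lemma (in group_action) pi_group_moved_orbits:
  assumes fin: "finite E" and q: "pi_number {q} (order G)"
  shows "q dvd card {s \<in> E. \<exists>g\<in>carrier G. \<phi> g s \<noteq> s}"
proof -
  let ?M = "{s \<in> E. \<exists>g\<in>carrier G. \<phi> g s \<noteq> s}"
  interpret group G
    using group_hom group_hom.axioms(1) by auto
  let ?O = "{U \<in> orbits G E \<phi>. U \<subseteq> ?M}"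
  have sub: "U \<subseteq> E" if "U \<in> orbits G E \<phi>" for U
    using that orbits_coverture by blast
  \<comment> \<open>A point of the orbit other than \<open>s\<close> is itself moved, namely by an
    element that carries it back to \<open>s\<close>.\<close>
  have orb: "orbit G \<phi> s \<subseteq> ?M" if s: "s \<in> ?M" for s
  proof
    fix t assume t: "t \<in> orbit G \<phi> s"
    have tE: "t \<in> E" using t s element_image by (auto simp: orbit_def)
    have "s \<in> orbit G \<phi> t" using orbit_sym s t tE by blast
    then obtain h where h: "h \<in> carrier G" "\<phi> h t = s" by (auto simp: orbit_def)
    show "t \<in> ?M"
    proof (cases "t = s")
      case False
      then show ?thesis using h tE by (intro CollectI conjI bexI[of _ h]) auto
    qed (use s in simp)
  qed
  have "?M = \<Union> ?O"
    using orb orbit_refl by (fastforce simp: orbits_def)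
  moreover have "card (\<Union> ?O) = sum card ?O"
  proof (rule card_Union_disjoint)
    show "pairwise disjnt ?O"
      using disjoint_union by (auto simp: pairwise_def disjnt_def)
  qed (use fin finite_subset sub in blast)
  moreover have "q dvd card U" if U: "U \<in> ?O" for U
  proof -
    obtain s where s: "s \<in> E" "U = orbit G \<phi> s" using U by (auto simp: orbits_def)
    have dvd: "card U dvd order G"
      using orbit_stabilizer_theorem[OF s(1)] s by (metis dvd_triv_left)
    have "s \<in> ?M" using U s orbit_refl by auto
    then obtain g where g: "g \<in> carrier G" "\<phi> g s \<noteq> s" by auto
    have "{s, \<phi> g s} \<subseteq> U" using s g orbit_refl by (auto simp: orbit_def)
    moreover have "finite U" using s sub[of U] fin finite_subset by (auto simp: orbits_def)
    ultimately have "card U \<noteq> 1"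
      using g by (auto simp: card_1_singleton_iff)
    then show ?thesis
      using pi_number_singleton_dvd[OF q dvd] by simp
  qed
  ultimately show ?thesis
    by (metis (no_types, lifting) dvd_sum)
qed

section \<open>Conjugation and its action on subsets\<close>

definition (in group) conjugate :: "'a \<Rightarrow> 'a \<Rightarrow> 'a" where
  "conjugate g a = g \<otimes> a \<otimes> inv g"

context group
begin

lemma conjugate_closed [simp]:
  "g \<in> carrier G \<Longrightarrow> a \<in> carrier G \<Longrightarrow> conjugate g a \<in> carrier G"
  by (simp add: conjugate_def)

lemma conjugate_one [simp]: "a \<in> carrier G \<Longrightarrow> conjugate \<one> a = a"
  by (simp add: conjugate_def)

lemma conjugate_mult:
  "\<lbrakk>g \<in> carrier G; h \<in> carrier G; a \<in> carrier G\<rbrakk>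
    \<Longrightarrow> conjugate (g \<otimes> h) a = conjugate g (conjugate h a)"
  by (simp add: conjugate_def inv_mult_group m_assoc)

lemma conjugate_inv_cancel [simp]:
  "g \<in> carrier G \<Longrightarrow> a \<in> carrier G \<Longrightarrow> conjugate (inv g) (conjugate g a) = a"
  "g \<in> carrier G \<Longrightarrow> a \<in> carrier G \<Longrightarrow> conjugate g (conjugate (inv g) a) = a"
  by (simp_all flip: conjugate_mult)

lemma conjugate_fixed_iff:
  "g \<in> carrier G \<Longrightarrow> a \<in> carrier G \<Longrightarrow> conjugate g a = a \<longleftrightarrow> g \<otimes> a = a \<otimes> g"
  by (metis conjugate_def inv_solve_right m_closed)

lemma conjugate_hom:
  assumes "g \<in> carrier G" "a \<in> carrier G" "b \<in> carrier G"
  shows "conjugate g (a \<otimes> b) = conjugate g a \<otimes> conjugate g b"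
proof -
  have "inv g \<otimes> (g \<otimes> (b \<otimes> inv g)) = b \<otimes> inv g"
    using assms by (simp flip: m_assoc)
  then show ?thesis
    using assms by (simp add: conjugate_def m_assoc)
qed

lemma inj_on_conjugate: "g \<in> carrier G \<Longrightarrow> inj_on (conjugate g) (carrier G)"
  by (metis conjugate_inv_cancel(1) inj_onI)

lemma card_conjugate_image:
  "g \<in> carrier G \<Longrightarrow> E \<subseteq> carrier G \<Longrightarrow> card (conjugate g ` E) = card E"
  by (meson card_image inj_on_conjugate inj_on_subset)

lemma conjugate_image_mult:
  "\<lbrakk>g \<in> carrier G; h \<in> carrier G; E \<subseteq> carrier G\<rbrakk>
    \<Longrightarrow> conjugate (g \<otimes> h) ` E = conjugate g ` conjugate h ` E"
  unfolding image_image by (rule image_cong) (auto simp: conjugate_mult)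

lemma conjugate_image_one: "E \<subseteq> carrier G \<Longrightarrow> conjugate \<one> ` E = E"
  by (simp add: subset_iff)

lemma conjugate_image_inv_iff:
  assumes "g \<in> carrier G" "E \<subseteq> carrier G" "F \<subseteq> carrier G"
  shows "conjugate (inv g) ` F = E \<longleftrightarrow> F = conjugate g ` E"
  using conjugate_image_mult[of g "inv g" F] conjugate_image_mult[of "inv g" g E]
    conjugate_image_one[OF assms(2)] conjugate_image_one[OF assms(3)] assms by auto

lemma conjugate_image_eqI:
  assumes "finite (carrier G)" "g \<in> carrier G" "E \<subseteq> carrier G" "conjugate g ` E \<subseteq> E"
  shows "conjugate g ` E = E"
  using assms by (meson card_subset_eq card_conjugate_image finite_subset)

lemma conjugation_action:
  "subgroup Q G \<Longrightarrow> (\<And>g s. g \<in> Q \<Longrightarrow> s \<in> S \<Longrightarrow> conjugate g ` s \<in> S) \<Longrightarrow> S \<subseteq> Pow (carrier G)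
    \<Longrightarrow> group_action (G\<lparr>carrier := Q\<rparr>) S (\<lambda>g. \<lambda>s\<in>S. conjugate g ` s)"
  by (rule group.action_by_closed_map[OF subgroup_imp_group])
    (auto simp: conjugate_image_one conjugate_image_mult subset_iff subgroup.mem_carrier)

text \<open>Normalizers grow in a group of prime power order, for subsets in place of subgroups:
  \<open>E\<close> acts on the set of \<open>Q\<close>-conjugates of \<open>E\<close>, whose size is a power of \<open>q\<close>, and fixes \<open>E\<close>;
  hence it fixes another conjugate.\<close>

lemma normalizing_element_exists:
  assumes fin: "finite (carrier G)" and q: "prime q" and Q: "pi_subgroup Q {q} G"
    and BQ: "B \<subseteq> Q" and B: "\<And>g b. g \<in> Q \<Longrightarrow> b \<in> B \<Longrightarrow> conjugate g b \<in> B"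
    and E: "E \<subset> B" "\<And>e. e \<in> E \<Longrightarrow> conjugate e ` E = E"
  shows "\<exists>u\<in>B - E. conjugate u ` E = E"
proof (cases "\<forall>g\<in>Q. conjugate g ` E = E")
  case True
  then show ?thesis using E BQ by blast
next
  case False
  define S where "S = (\<lambda>g. conjugate g ` E) ` Q"
  have sQ: "subgroup Q G" and pQ: "pi_number {q} (card Q)"
    using Q by (auto simp: pi_subgroup_def)
  have Qc: "Q \<subseteq> carrier G" using sQ subgroup.subset by blast
  have Ec: "E \<subseteq> carrier G" using E BQ Qc by blast
  have oneQ: "\<one> \<in> Q" using sQ subgroup.one_closed by blast
  have ES: "E \<in> S"
    using oneQ conjugate_image_one[OF Ec] unfolding S_def by (metis image_eqI)
  have Scl: "conjugate g ` s \<in> S" if gs: "g \<in> Q" "s \<in> S" for g s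
  proof -
    obtain h where h: "h \<in> Q" "s = conjugate h ` E" using gs(2) by (auto simp: S_def)
    then have "conjugate g ` s = conjugate (g \<otimes> h) ` E"
      using gs Ec Qc by (simp add: conjugate_image_mult subset_iff)
    then show ?thesis
      using h gs subgroup.m_closed[OF sQ] by (auto simp: S_def)
  qed
  have Sc: "S \<subseteq> Pow (carrier G)"
    using Ec Qc by (auto simp: S_def subset_iff)
  have finS: "finite S" using fin Qc finite_subset unfolding S_def by blast
  \<comment> \<open>Orbit counting needs a group, so \<open>E\<close> acts through the subgroup it
    generates. This lies in \<open>Q\<close>, and it stabilizes \<open>E\<close> because its
    generators do.\<close>
  define F where "F = generate G E"
  have sF: "subgroup F G" using generate_is_subgroup Ec by (simp add: F_def)
  have EQ: "E \<subseteq> Q" using E BQ by blast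
  have FQ: "F \<subseteq> Q" using generate_subgroup_incl[OF EQ sQ] by (simp add: F_def)
  have pF: "pi_number {q} (card F)"
    using pi_subgroup_subset[OF Q sF FQ fin] by (simp add: pi_subgroup_def)
  interpret AQ: group_action "G\<lparr>carrier := Q\<rparr>" S "\<lambda>g. \<lambda>s\<in>S. conjugate g ` s"
    by (rule conjugation_action[OF sQ Scl Sc])
  interpret AF: group_action "G\<lparr>carrier := F\<rparr>" S "\<lambda>g. \<lambda>s\<in>S. conjugate g ` s"
    by (rule conjugation_action[OF sF _ Sc]) (use Scl FQ in blast)
  have "orbit (G\<lparr>carrier := Q\<rparr>) (\<lambda>g. \<lambda>s\<in>S. conjugate g ` s) E = S"
    using ES by (auto simp: orbit_def S_def)
  then have "card S dvd order (G\<lparr>carrier := Q\<rparr>)"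
    using AQ.orbit_stabilizer_theorem[OF ES] by (metis dvd_triv_left)
  then have "card S dvd card Q"
    by (simp add: order_def)
  moreover have "card S \<noteq> 1"
  proof
    assume "card S = 1"
    then obtain s where "S = {s}" by (rule card_1_singletonE)
    then show False using False ES Scl by blast
  qed
  ultimately have qS: "q dvd card S"
    using pi_number_singleton_dvd[OF pQ] by blast
  let ?M = "{s \<in> S. \<exists>g\<in>F. conjugate g ` s \<noteq> s}"
  have "{s \<in> S. \<exists>g\<in>carrier (G\<lparr>carrier := F\<rparr>). (\<lambda>s\<in>S. conjugate g ` s) s \<noteq> s} = ?M"
    by auto
  then have qM: "q dvd card ?M"
    using AF.pi_group_moved_orbits[OF finS, of q] pF by (simp add: order_def)
  have EF: "E \<subseteq> F" unfolding F_def by (rule subsetI) (rule generate.incl)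
  have fixed: "conjugate g ` E = E" if "g \<in> F" for g
  proof -
    have "g \<in> generate G E" using that by (simp add: F_def)
    then show ?thesis
    proof induction
      case one then show ?case using Ec by (simp add: conjugate_image_one)
    next
      case (incl h) then show ?case by (rule E(2))
    next
      case (inv h)
      then have "h \<in> carrier G" "conjugate h ` E = E" using E(2) Ec by blast+
      then show ?case
        using conjugate_image_inv_iff[OF _ Ec Ec, of h] by simp
    next
      case (eng h k)
      then have "conjugate (h \<otimes> k) ` E = conjugate h ` conjugate k ` E"
        by (intro conjugate_image_mult generate_in_carrier[OF Ec] Ec)
      then show ?case by (simp only: eng)
    qed
  qed
  \<comment> \<open>\<open>q\<close> divides both the number of conjugates and the number of moved
    ones, so \<open>E\<close> cannot be the only one left fixed.\<close>
  have "?M \<noteq> S - {E}"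
  proof
    assume "?M = S - {E}"
    then have "card S = Suc (card ?M)"
      using card_Suc_Diff1[OF finS ES] by simp
    then have "q dvd 1"
      using qS qM dvd_add_right_iff[of q "card ?M" 1] by simp
    then show False
      using q not_prime_unit by blast
  qed
  moreover have "?M \<subseteq> S - {E}"
  proof
    fix s assume "s \<in> ?M"
    then obtain g where "s \<in> S" "g \<in> F" "conjugate g ` s \<noteq> s" by (elim CollectE conjE bexE)
    then show "s \<in> S - {E}" using fixed[of g] by (cases "s = E") auto
  qed
  ultimately obtain s where s: "s \<in> S" "s \<noteq> E" "s \<notin> ?M" by blast
  then obtain g where g: "g \<in> Q" "s = conjugate g ` E" by (auto simp: S_def)
  have fixes_s: "conjugate e ` conjugate g ` E = conjugate g ` E" if "e \<in> E" for e
  proof (rule ccontr)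
    assume "conjugate e ` conjugate g ` E \<noteq> conjugate g ` E"
    then have "s \<in> ?M" using s(1) g(2) that EF by (intro CollectI conjI bexI[of _ e]) (auto simp only: subsetD)
    then show False using s(3) by contradiction
  qed
  have gc: "g \<in> carrier G" using g Qc by blast
  have "conjugate (inv g) ` E \<noteq> E"
    using g(2) s(2) conjugate_image_inv_iff[OF gc Ec Ec] by simp
  then obtain e where e: "e \<in> E" "conjugate (inv g) e \<notin> E"
    using conjugate_image_eqI[OF fin _ Ec, of "inv g"] gc by auto
  define u where "u = conjugate (inv g) e"
  have ec: "e \<in> carrier G" using e Ec by blast
  have "u \<in> B - E"
    using e B[of "inv g" e] g E subgroup.m_inv_closed[OF sQ] by (auto simp: u_def)
  moreover have "conjugate u ` E = E"
  proof -
    have "u = inv g \<otimes> e \<otimes> g" using gc by (simp add: u_def conjugate_def)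
    then have "conjugate u ` E = conjugate (inv g) ` conjugate e ` conjugate g ` E"
      using gc ec Ec by (simp add: conjugate_image_mult image_subset_iff subset_iff m_assoc)
    also have "\<dots> = conjugate (inv g) ` conjugate g ` E" using fixes_s e by simp
    also have "\<dots> = E"
      by (rule conjugate_image_inv_iff[OF gc Ec, THEN iffD2]) (use gc Ec in auto)
    finally show ?thesis .
  qed
  ultimately show ?thesis by blast
qed

text \<open>By Bezout, \<open>a\<close> is a product of integer powers of \<open>a [^] k\<close> and
  \<open>a [^] l\<close>. With \<open>l\<close> the order of \<open>a\<close>, this passes from a
  suitable power of \<open>a\<close> back to \<open>a\<close>.\<close>

lemma coprime_pows_mem:
  assumes "subgroup H G" "a \<in> carrier G" "a [^] (k::nat) \<in> H" "a [^] (l::nat) \<in> H" "coprime k l"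
  shows "a \<in> H"
proof -
  obtain u v where uv: "u * int k + v * int l = 1"
    using assms(5) bezout_int[of "int k" "int l"] by auto
  have pow: "a [^] (w * int m) \<in> H" if "a [^] m \<in> H" for w and m :: nat
    using subgroup_int_pow_closed[OF assms(1) that, of w] assms(2)
    by (simp add: int_pow_pow mult.commute flip: int_pow_int)
  have "a [^] (u * int k) \<otimes> a [^] (v * int l) = a [^] (1::int)"
    using assms(2) by (simp add: int_pow_mult flip: uv)
  moreover have "a [^] (u * int k) \<otimes> a [^] (v * int l) \<in> H"
    by (rule subgroup.m_closed[OF assms(1) pow[OF assms(3)] pow[OF assms(4)]])
  ultimately show ?thesis using assms(2) by simp
qed

lemma subgroup_conjugate_image:
  assumes "subgroup Q G" "g \<in> carrier G"
  shows "subgroup (conjugate g ` Q) G"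
proof (rule subgroupI)
  note Q = subgroup.mem_carrier[OF assms(1)]
  show "conjugate g ` Q \<subseteq> carrier G" using Q assms(2) by auto
  show "conjugate g ` Q \<noteq> {}" using subgroup.one_closed[OF assms(1)] by blast
  show "inv a \<in> conjugate g ` Q" if "a \<in> conjugate g ` Q" for a
  proof -
    from that obtain h where h: "h \<in> Q" "a = conjugate g h" by auto
    then have "inv a = conjugate g (inv h)"
      using Q assms(2) by (simp add: conjugate_def inv_mult_group m_assoc)
    then show ?thesis using h subgroup.m_inv_closed[OF assms(1)] by blast
  qed
  show "a \<otimes> b \<in> conjugate g ` Q" if "a \<in> conjugate g ` Q" "b \<in> conjugate g ` Q" for a b
    using that Q assms subgroup.m_closed[OF assms(1)]
    by (auto simp flip: conjugate_hom)
qed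

lemma subgroup_set_stabilizer:
  assumes "E \<subseteq> carrier G"
  shows "subgroup {g \<in> carrier G. conjugate g ` E = E} G"
proof (rule subgroupI)
  show "inv a \<in> {g \<in> carrier G. conjugate g ` E = E}"
    if "a \<in> {g \<in> carrier G. conjugate g ` E = E}" for a
    using that conjugate_image_inv_iff[of a E E] assms by auto
  show "a \<otimes> b \<in> {g \<in> carrier G. conjugate g ` E = E}"
    if "a \<in> {g \<in> carrier G. conjugate g ` E = E}" "b \<in> {g \<in> carrier G. conjugate g ` E = E}" for a b
    using that conjugate_image_mult[of a b E] assms by auto
qed (use conjugate_image_one[OF assms] in auto)

end

section \<open>Critical classes and their blocks\<close>

lemma coprime_of_less_prime:
  assumes "prime (q::nat)" "pi_number {q} n" "0 < k" "k < q"
  shows "coprime k n"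
proof (rule ccontr)
  assume "\<not> coprime k n"
  then obtain r where "prime r" "r dvd k" "r dvd n"
    using prime_factor_nat[of "gcd k n"] by (auto simp: coprime_iff_gcd_eq_1)
  then show False
    using assms by (metis dvd_imp_le linorder_not_le pi_number_def singletonD)
qed

text \<open>The situation inside the minimal subgroup, which becomes the whole group here.
  \<open>Y_core\<close> says that \<open>Y\<close> avoids the q-core, and \<open>Y_proper\<close>
  expresses minimality. \<open>Y\<close> need not be a single class: conjugates of one element under
  a larger group may split into several classes.\<close>

locale critical_class = group G for G :: "('a, 'b) monoid_scheme" (structure) +
  fixes q :: nat and Y :: "'a set"
  assumes fin: "finite (carrier G)"
    and prime_q: "prime q"
    and Y_carrier: "Y \<subseteq> carrier G"
    and Y_conjugate: "\<And>g a. g \<in> carrier G \<Longrightarrow> a \<in> Y \<Longrightarrow> conjugate g a \<in> Y"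
    and Y_ord: "\<And>a. a \<in> Y \<Longrightarrow> pi_number {q} (ord a)"
    and Y_core: "Y \<inter> pi_core {q} G = {}"
    and Y_proper: "\<And>H. subgroup H G \<Longrightarrow> H \<noteq> carrier G \<Longrightarrow> Y \<inter> H \<subseteq> pi_core {q} (G\<lparr>carrier := H\<rparr>)"
begin

text \<open>For \<open>E\<close> inside the carrier this amounts to \<open>E\<close> generating a
  group of \<open>q\<close>-power order; phrased by containment, it passes to subsets at
  once.\<close>

definition q_bounded :: "'a set \<Rightarrow> bool" where
  "q_bounded E \<longleftrightarrow> (\<exists>Q. pi_subgroup Q {q} G \<and> E \<subseteq> Q)"

text \<open>Maximality is by inclusion among the q-bounded subsets of \<open>Y\<close>. By
  \<open>block_eq\<close> a block is the trace on \<open>Y\<close> of any q-subgroup containing it,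
  as in Sylow-type arguments.\<close>

definition block :: "'a set \<Rightarrow> bool" where
  "block B \<longleftrightarrow> B \<subseteq> Y \<and> q_bounded B \<and> (\<forall>C. C \<subseteq> Y \<longrightarrow> B \<subseteq> C \<longrightarrow> q_bounded C \<longrightarrow> C = B)"

lemma q_bounded_subset: "q_bounded E \<Longrightarrow> F \<subseteq> E \<Longrightarrow> q_bounded F"
  by (auto simp: q_bounded_def)

text \<open>The q-core of \<open>H\<close> is a q-subgroup of the whole group too, and minimality
  places \<open>Y \<inter> H\<close> inside it.\<close>

lemma q_bounded_proper:
  assumes "subgroup H G" "H \<noteq> carrier G"
  shows "q_bounded (Y \<inter> H)"
proof -
  let ?C = "pi_core {q} (G\<lparr>carrier := H\<rparr>)"
  have "finite H" using assms(1) fin finite_subset subgroup.subset by blast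
  then have "pi_subgroup ?C {q} (G\<lparr>carrier := H\<rparr>)"
    using group.pi_core_greatest(2)[OF subgroup_imp_group[OF assms(1)]] by simp
  then have "pi_subgroup ?C {q} G"
    using incl_subgroup[OF assms(1)] by (auto simp: pi_subgroup_def)
  then show ?thesis using Y_proper[OF assms] by (auto simp: q_bounded_def)
qed

lemma q_bounded_singleton:
  assumes "a \<in> Y" shows "q_bounded {a}"
proof -
  have "a \<in> carrier G" using assms Y_carrier by blast
  then have "pi_subgroup (generate G {a}) {q} G"
    using generate_pow_card[of a] generate_is_subgroup[of "{a}"] Y_ord[OF assms]
    by (simp add: pi_subgroup_def)
  moreover have "a \<in> generate G {a}" by (simp add: generate.incl)
  ultimately show ?thesis by (auto simp: q_bounded_def)
qed

lemma finite_Y: "finite Y"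
  using fin Y_carrier finite_subset by blast

lemma block_extension:
  assumes "E \<subseteq> Y" "q_bounded E"
  obtains B where "block B" "E \<subseteq> B"
proof -
  let ?S = "{C. E \<subseteq> C \<and> C \<subseteq> Y \<and> q_bounded C}"
  have "finite ?S" using finite_Y by (auto intro: finite_subset[of _ "Pow Y"])
  then obtain B where "B \<in> ?S" "\<And>C. C \<in> ?S \<Longrightarrow> B \<subseteq> C \<Longrightarrow> B = C"
    using finite_has_maximal2[of ?S E] assms by auto
  then have "block B" "E \<subseteq> B" unfolding block_def by blast+
  then show ?thesis using that by blast
qed

lemma block_eq:
  assumes "block B" "pi_subgroup Q {q} G" "B \<subseteq> Q"
  shows "B = Y \<inter> Q"
proof -
  have "q_bounded (Y \<inter> Q)" using assms by (auto simp: q_bounded_def)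
  moreover have "B \<subseteq> Y \<inter> Q" using assms by (auto simp: block_def)
  ultimately show ?thesis using assms(1) unfolding block_def by blast
qed

text \<open>Such a set generates a normal q-subgroup, which lies in the q-core, while
  \<open>Y\<close> is disjoint from the core. This supplies proper stabilizers and shows that one
  block cannot exhaust a nonempty \<open>Y\<close>.\<close>

lemma normal_q_bounded_empty:
  assumes "E \<subseteq> Y" "q_bounded E" "\<And>g. g \<in> carrier G \<Longrightarrow> conjugate g ` E \<subseteq> E"
  shows "E = {}"
proof -
  obtain Q where Q: "pi_subgroup Q {q} G" "E \<subseteq> Q" using assms by (auto simp: q_bounded_def)
  let ?F = "generate G E"
  have EC: "E \<subseteq> carrier G" using assms Y_carrier by blast
  have "?F \<lhd> G"
    by (rule normal_generateI[OF EC]) (use assms(3) in \<open>auto simp: conjugate_def\<close>)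
  moreover have "pi_subgroup ?F {q} G"
    using pi_subgroup_subset[OF Q(1) generate_is_subgroup[OF EC]] fin
      generate_subgroup_incl[OF Q(2)] Q by (simp add: pi_subgroup_def)
  ultimately have "?F \<subseteq> pi_core {q} G"
    by (rule pi_core_greatest(3)[OF fin])
  moreover have "E \<subseteq> ?F" by (auto intro: generate.incl)
  ultimately show ?thesis using Y_core assms(1) by blast
qed

text \<open>If the stabilizer were the whole group, \<open>E\<close> would be invariant under
  conjugation and hence empty; so it is proper and minimality applies to it.\<close>

lemma q_bounded_stabilizer:
  assumes "E \<subseteq> Y" "E \<noteq> {}" "q_bounded E"
  shows "q_bounded (Y \<inter> {g \<in> carrier G. conjugate g ` E = E})"
proof (rule q_bounded_proper)
  show "subgroup {g \<in> carrier G. conjugate g ` E = E} G"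
    using subgroup_set_stabilizer assms Y_carrier by blast
  show "{g \<in> carrier G. conjugate g ` E = E} \<noteq> carrier G"
    using normal_q_bounded_empty[OF assms(1,3)] assms(2) by auto
qed

text \<open>Among the distinct blocks that meet, take two with the largest intersection \<open>E\<close>. Each contains
  an element outside \<open>E\<close> that normalizes \<open>E\<close>; as the stabilizer of \<open>E\<close> is proper, one block contains
  both of these elements and \<open>E\<close>, and maximality identifies it with both blocks.\<close>

lemma blocks_disjoint:
  assumes "block A" "block B" "A \<noteq> B"
  shows "A \<inter> B = {}"
proof (rule ccontr)
  assume "A \<inter> B \<noteq> {}"
  define P where "P = (\<lambda>(A, B). block A \<and> block B \<and> A \<noteq> B \<and> A \<inter> B \<noteq> {})"
  have "P (A, B)" using assms \<open>A \<inter> B \<noteq> {}\<close> by (simp add: P_def)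
  moreover have "\<forall>z. P z \<longrightarrow> card (fst z \<inter> snd z) < Suc (card Y)"
    using finite_Y by (auto simp: P_def block_def less_Suc_eq_le intro!: card_mono)
  ultimately obtain z where z: "P z" "\<And>z'. P z' \<Longrightarrow> card (fst z' \<inter> snd z') \<le> card (fst z \<inter> snd z)"
    using ex_has_greatest_nat[of P "(A, B)" "\<lambda>z. card (fst z \<inter> snd z)"] by (metis less_imp_le)
  \<comment> \<open>From here on \<open>A\<close> and \<open>B\<close> are the pair with the largest
    intersection, no longer the blocks of the statement.\<close>
  obtain A B where AB: "z = (A, B)" by fastforce
  have max: "card (C \<inter> D) \<le> card (A \<inter> B)" if "block C" "block D" "C \<noteq> D" "C \<inter> D \<noteq> {}" for C D
    using z(2)[of "(C, D)"] that by (simp add: P_def AB)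
  have A: "block A" and B: "block B" and ne: "A \<noteq> B" "A \<inter> B \<noteq> {}"
    using z(1) by (auto simp: P_def AB)
  let ?E = "A \<inter> B"
  have sub: "A \<subseteq> Y" "B \<subseteq> Y" using A B by (auto simp: block_def)
  obtain R S where R: "pi_subgroup R {q} G" "A \<subseteq> R" and S: "pi_subgroup S {q} G" "B \<subseteq> S"
    using A B by (auto simp: block_def q_bounded_def)
  have AR: "A = Y \<inter> R" and BS: "B = Y \<inter> S" using block_eq A B R S by auto
  have conj_R: "conjugate g a \<in> Y \<inter> R" if "pi_subgroup R {q} G" "g \<in> R" "a \<in> Y \<inter> R" for g a R
  proof -
    have "subgroup R G" using that by (simp add: pi_subgroup_def)
    then have "conjugate g a \<in> R" "g \<in> carrier G"
      using that by (auto simp: conjugate_def subgroup.m_closed subgroup.m_inv_closed subgroup.mem_carrier)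
    then show ?thesis
      using that Y_conjugate by blast
  qed
  have Ec: "?E \<subseteq> carrier G" using sub Y_carrier by blast
  have Estab: "conjugate e ` ?E = ?E" if "e \<in> ?E" for e
  proof (rule conjugate_image_eqI[OF fin _ Ec])
    show "conjugate e ` ?E \<subseteq> ?E"
      using that conj_R[OF R(1), of e] conj_R[OF S(1), of e] AR BS by blast
  qed (use that Ec in blast)
  have "\<not> A \<subseteq> B" "\<not> B \<subseteq> A" using A B ne by (auto simp: block_def)
  then have "?E \<subset> A" "?E \<subset> B" by auto
  have "\<exists>u\<in>A - ?E. conjugate u ` ?E = ?E"
    by (rule normalizing_element_exists[OF fin prime_q R _ \<open>?E \<subset> A\<close> Estab])
      (use conj_R[OF R(1)] AR in blast)
  then obtain u where u: "u \<in> A - ?E" "conjugate u ` ?E = ?E" by blast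
  have "\<exists>v\<in>B - ?E. conjugate v ` ?E = ?E"
    by (rule normalizing_element_exists[OF fin prime_q S _ \<open>?E \<subset> B\<close> Estab])
      (use conj_R[OF S(1)] BS in blast)
  then obtain v where v: "v \<in> B - ?E" "conjugate v ` ?E = ?E" by blast
  let ?N = "Y \<inter> {g \<in> carrier G. conjugate g ` ?E = ?E}"
  have "q_bounded ?N"
  proof (rule q_bounded_stabilizer)
    show "q_bounded ?E" using A q_bounded_subset[of A ?E] by (simp add: block_def)
  qed (use sub ne in auto)
  then obtain C where C: "block C" "?N \<subseteq> C" using block_extension by blast
  have "?E \<subseteq> ?N" using Estab Ec sub(1) by auto
  moreover have "u \<in> ?N" "v \<in> ?N" using u v sub Y_carrier by auto
  ultimately have ins: "insert u ?E \<subseteq> ?N" "insert v ?E \<subseteq> ?N"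
    by (simp_all only: insert_subset simp_thms)
  note mem = ins[THEN order_trans[OF _ C(2)]]
  \<comment> \<open>A block \<open>D\<close> other than \<open>C\<close> would meet \<open>C\<close>
    in \<open>?E\<close> and the further element \<open>w\<close>, exceeding the largest
    intersection.\<close>
  have eqC: "D = C" if "block D" "insert w ?E \<subseteq> D" "w \<notin> ?E" "insert w ?E \<subseteq> C" for D w
  proof (rule ccontr)
    assume "D \<noteq> C"
    then have "card (D \<inter> C) \<le> card ?E" using max[OF that(1) C(1)] that by blast
    moreover have "insert w ?E \<subseteq> D \<inter> C" using that by blast
    moreover have "finite (D \<inter> C)" "finite ?E"
      using that(1) finite_Y finite_subset Ec fin unfolding block_def by blast+
    ultimately have "card (insert w ?E) \<le> card ?E" by (meson card_mono order_trans)
    then show False using that(3) \<open>finite ?E\<close> by simp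
  qed
  have "A = C" using eqC[OF A] u mem by blast
  moreover have "B = C" using eqC[OF B] v mem by blast
  ultimately show False using ne by simp
qed

lemma block_conjugate:
  assumes B: "block B" and g: "g \<in> carrier G"
  shows "block (conjugate g ` B)"
proof -
  have q: "q_bounded (conjugate h ` E)" if "q_bounded E" "h \<in> carrier G" for h E
  proof -
    from that obtain Q where Q: "pi_subgroup Q {q} G" "E \<subseteq> Q" by (auto simp: q_bounded_def)
    then have "pi_subgroup (conjugate h ` Q) {q} G"
      using subgroup_conjugate_image[of Q h] card_conjugate_image[OF that(2) subgroup.subset, of Q] that(2)
      by (simp add: pi_subgroup_def)
    then show ?thesis using Q by (auto simp: q_bounded_def)
  qed
  have BY: "B \<subseteq> Y" using B by (simp add: block_def)
  \<comment> \<open>Maximality is transported back: conjugating \<open>C\<close> by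
    \<open>inv g\<close> gives a q-bounded subset of \<open>Y\<close> that contains
    \<open>B\<close>.\<close>
  have "C = conjugate g ` B" if C: "C \<subseteq> Y" "conjugate g ` B \<subseteq> C" "q_bounded C" for C
  proof -
    have "B \<subseteq> conjugate (inv g) ` C"
    proof
      fix b assume "b \<in> B"
      then have "conjugate (inv g) (conjugate g b) \<in> conjugate (inv g) ` C" using C by blast
      then show "b \<in> conjugate (inv g) ` C" using \<open>b \<in> B\<close> BY Y_carrier g by auto
    qed
    moreover have "conjugate (inv g) ` C \<subseteq> Y" using C Y_conjugate g by blast
    ultimately have "conjugate (inv g) ` C = B"
      using B q[OF C(3), of "inv g"] g by (auto simp: block_def)
    then show ?thesis
      using conjugate_image_inv_iff[OF g, of B C] BY C Y_carrier by blast
  qed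
  moreover have "conjugate g ` B \<subseteq> Y" using BY Y_conjugate g by blast
  moreover have "q_bounded (conjugate g ` B)" using B q g by (simp add: block_def)
  ultimately show ?thesis by (simp add: block_def)
qed

lemma block_nonempty: "a \<in> Y \<Longrightarrow> block B \<Longrightarrow> B \<noteq> {}"
  using q_bounded_singleton[of a] by (auto simp: block_def)

text \<open>The elements of \<open>Y\<close> that stabilize \<open>B\<close> form a q-bounded set.
  It contains \<open>B\<close>, since \<open>B\<close> is the trace of a q-subgroup on
  \<open>Y\<close>, and so equals \<open>B\<close> by maximality.\<close>

lemma block_self_normalizing:
  assumes "block B" "a \<in> Y" "conjugate a ` B = B"
  shows "a \<in> B"
proof -
  let ?N = "Y \<inter> {g \<in> carrier G. conjugate g ` B = B}"
  obtain R where R: "pi_subgroup R {q} G" "B \<subseteq> R"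
    using assms by (auto simp: block_def q_bounded_def)
  have sR: "subgroup R G" using R by (simp add: pi_subgroup_def)
  have BY: "B \<subseteq> Y" using assms by (simp add: block_def)
  have "conjugate b ` B = B" if "b \<in> B" for b
  proof (rule conjugate_image_eqI[OF fin])
    show "conjugate b ` B \<subseteq> B"
    proof
      fix c assume "c \<in> conjugate b ` B"
      then obtain d where d: "d \<in> B" "c = conjugate b d" by blast
      have "c \<in> R" using d that R(2) sR
        by (auto simp: conjugate_def intro!: subgroup.m_closed subgroup.m_inv_closed)
      moreover have "c \<in> Y" using d that BY Y_carrier Y_conjugate by blast
      ultimately show "c \<in> B" using block_eq[OF assms(1) R] by blast
    qed
  qed (use that BY Y_carrier in blast)+
  then have "B \<subseteq> ?N" using BY Y_carrier by blast
  moreover have "q_bounded ?N"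
    using q_bounded_stabilizer[OF BY] block_nonempty[OF assms(2,1)] assms(1) by (simp add: block_def)
  ultimately have "?N = B" using assms(1) unfolding block_def by blast
  then show ?thesis using assms Y_carrier by blast
qed

text \<open>If the generated subgroup were proper, \<open>{a, b}\<close> would be q-bounded and lie
  in one block, which meets both \<open>A\<close> and \<open>B\<close> and so, by disjointness,
  equals both.\<close>

lemma generate_distinct_blocks:
  assumes "block A" "block B" "A \<noteq> B" "a \<in> A" "b \<in> B"
  shows "generate G {a, b} = carrier G"
proof (rule ccontr)
  assume ne: "generate G {a, b} \<noteq> carrier G"
  have ab: "{a, b} \<subseteq> Y" using assms by (auto simp: block_def)
  then have "subgroup (generate G {a, b}) G"
    using generate_is_subgroup Y_carrier by blast
  moreover have "{a, b} \<subseteq> generate G {a, b}" by (auto intro: generate.incl)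
  ultimately have "q_bounded {a, b}"
    using q_bounded_proper[OF _ ne] ab by (meson Int_greatest q_bounded_subset)
  then obtain C where C: "block C" "{a, b} \<subseteq> C" using block_extension ab by blast
  then have "A = C" "B = C" using blocks_disjoint assms by blast+
  then show False using assms by simp
qed

text \<open>The elements are taken from pairwise distinct blocks: that of \<open>a\<close>, and the
  conjugates by powers of \<open>a\<close> of a second block. The last conclusion keeps these powers
  from centralizing \<open>b\<close>, which the later count of translates needs.\<close>

lemma generating_conjugates:
  assumes "Y \<noteq> {}"
  obtains a b where "a \<in> Y" "b \<in> Y"
    and "\<And>i. generate G {a, conjugate (a [^] (i::nat)) b} = carrier G"
    and "\<And>i j. i < j \<Longrightarrow> j < q \<Longrightarrow>
      generate G {conjugate (a [^] i) b, conjugate (a [^] j) b} = carrier G"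
    and "\<And>i. 0 < i \<Longrightarrow> i < q \<Longrightarrow> conjugate (a [^] i) b \<noteq> b"
proof -
  obtain a where a: "a \<in> Y" using assms by blast
  then obtain A where A: "block A" "a \<in> A"
    using block_extension q_bounded_singleton by (metis empty_subsetI insert_subset)
  have "\<not> Y \<subseteq> A"
  proof
    assume "Y \<subseteq> A"
    then have "q_bounded Y" using A q_bounded_subset unfolding block_def by blast
    then show False using normal_q_bounded_empty[of Y] Y_conjugate assms by blast
  qed
  then obtain b where b: "b \<in> Y" "b \<notin> A" by blast
  then obtain B where B: "block B" "b \<in> B"
    using block_extension q_bounded_singleton by (metis empty_subsetI insert_subset)
  have ac: "a \<in> carrier G" using a Y_carrier by blast
  have BY: "B \<subseteq> carrier G" using B Y_carrier by (auto simp: block_def)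
  have aB: "a \<notin> B" using blocks_disjoint[OF A(1) B(1)] A B b by blast
  define D where "D i = conjugate (a [^] i) ` B" for i :: nat
  have D: "block (D i)" "conjugate (a [^] i) b \<in> D i" for i
    using block_conjugate B ac by (auto simp: D_def)
  \<comment> \<open>Since \<open>a\<close> commutes with its own powers, \<open>a\<close> in
    \<open>D i\<close> would force \<open>a\<close> in \<open>B\<close>.\<close>
  have DA: "D i \<noteq> A" for i
  proof
    assume "D i = A"
    then obtain c where c: "c \<in> B" "a = conjugate (a [^] i) c" using A by (auto simp: D_def)
    have "conjugate (a [^] i) a = a"
      using ac nat_pow_Suc2[OF ac, of i] by (simp add: conjugate_fixed_iff)
    then have "c = a"
      using inj_onD[OF inj_on_conjugate[of "a [^] i"], of c a] c ac BY by auto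
    then show False using c aB by simp
  qed
  \<comment> \<open>Cancelling \<open>a [^] i\<close> leaves \<open>a [^] k\<close> stabilizing
    \<open>B\<close> with \<open>k\<close> strictly between 0 and \<open>q\<close>. As
    \<open>k\<close> is coprime to the order of \<open>a\<close>, already \<open>a\<close>
    stabilizes \<open>B\<close> and hence lies in it, a contradiction.\<close>
  have DD: "D i \<noteq> D j" if ij: "i < j" "j < q" for i j
  proof
    let ?N = "{g \<in> carrier G. conjugate g ` B = B}"
    define k where "k = j - i"
    have k: "0 < k" "k < q" "j = i + k" using ij by (auto simp: k_def)
    assume "D i = D j"
    then have "conjugate (a [^] i) ` B = conjugate (a [^] i) ` conjugate (a [^] k) ` B"
      using ac BY k(3) conjugate_image_mult[of "a [^] i" "a [^] k" B] by (simp add: D_def nat_pow_mult)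
    then have "conjugate (a [^] k) ` B = B"
      by (subst (asm) inj_on_image_eq_iff[OF inj_on_conjugate[of "a [^] i"]]) (use ac BY in auto)
    then have "a [^] k \<in> ?N" using ac by simp
    then have "a \<in> ?N"
    proof (rule coprime_pows_mem[OF subgroup_set_stabilizer[OF BY] ac])
      show "a [^] ord a \<in> ?N" using ac BY by (simp add: conjugate_image_one)
    qed (rule coprime_of_less_prime[OF prime_q Y_ord[OF a] k(1,2)])
    then show False using block_self_normalizing B a aB by blast
  qed
  have "b \<in> D 0"
    using B BY by (simp add: D_def conjugate_image_one)
  show ?thesis
  proof (rule that[OF a b(1)])
    show "generate G {a, conjugate (a [^] i) b} = carrier G" for i :: nat
      by (rule generate_distinct_blocks[OF A(1) D(1) DA[symmetric] A(2) D(2)])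
    show "generate G {conjugate (a [^] i) b, conjugate (a [^] j) b} = carrier G"
      if "i < j" "j < q" for i j
      by (rule generate_distinct_blocks[OF D(1) D(1) DD[OF that] D(2) D(2)])
    show "conjugate (a [^] i) b \<noteq> b" if "0 < i" "i < q" for i
      using blocks_disjoint[OF D(1) D(1) DD[OF that]] D(2)[of i] \<open>b \<in> D 0\<close> by auto
  qed
qed

end

section \<open>Orders and centralizers of pi-elements, and the passage to a minimal subgroup\<close>

context group
begin

lemma ord_consistent:
  assumes "subgroup H G" "h \<in> H"
  shows "group.ord (G\<lparr>carrier := H\<rparr>) h = ord h"
proof -
  interpret H: group "G\<lparr>carrier := H\<rparr>" by (rule subgroup_imp_group[OF assms(1)])
  have "h \<in> carrier G" using assms by (rule subgroup.mem_carrier)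
  then show ?thesis
    using assms(2) by (simp add: H.ord_unique pow_eq_id flip: nat_pow_consistent)
qed

lemma pi_elements_centralizer:
  assumes "x \<in> carrier G"
  shows "pi_elements (G\<lparr>carrier := centralizer G x\<rparr>) \<pi> = pi_elements G \<pi> \<inter> centralizer G x"
  using ord_consistent[OF centralizer_subgroup[OF assms]]
  by (auto simp: pi_elements_def centralizer_def)

lemma conjugate_pow:
  assumes "g \<in> carrier G" "a \<in> carrier G"
  shows "conjugate g a [^] (n::nat) = conjugate g (a [^] n)"
  by (induction n) (use assms in \<open>simp_all add: conjugate_hom, simp add: conjugate_def\<close>)

lemma ord_conjugate:
  assumes "g \<in> carrier G" "a \<in> carrier G"
  shows "ord (conjugate g a) = ord a"
proof -
  have "conjugate g c = \<one> \<longleftrightarrow> c = \<one>" if "c \<in> carrier G" for c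
    using that assms(1) inj_onD[OF inj_on_conjugate, of g c \<one>] by (auto simp: conjugate_def)
  then show ?thesis
    using assms by (simp add: ord_unique conjugate_pow pow_eq_id)
qed

lemma conjugate_pi_centralizer:
  assumes "g \<in> carrier G" "a \<in> carrier G" "t \<in> pi_elements G \<pi> \<inter> centralizer G a"
  shows "conjugate g t \<in> pi_elements G \<pi> \<inter> centralizer G (conjugate g a)"
  using assms by (auto simp: pi_elements_def centralizer_def ord_conjugate simp flip: conjugate_hom)

lemma card_pi_centralizer_conjugate:
  assumes "g \<in> carrier G" "a \<in> carrier G"
  shows "card (pi_elements G \<pi> \<inter> centralizer G (conjugate g a))
    = card (pi_elements G \<pi> \<inter> centralizer G a)"
proof -
  let ?C = "\<lambda>a. pi_elements G \<pi> \<inter> centralizer G a"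
  have "bij_betw (conjugate g) (?C a) (?C (conjugate g a))"
  proof (rule bij_betw_byWitness[of _ "conjugate (inv g)"])
    show "conjugate g ` ?C a \<subseteq> ?C (conjugate g a)"
      using conjugate_pi_centralizer[OF assms] by blast
    show "conjugate (inv g) ` ?C (conjugate g a) \<subseteq> ?C a"
      using conjugate_pi_centralizer[of "inv g" "conjugate g a"] assms by auto
  qed (use assms in \<open>auto simp: centralizer_def\<close>)
  then show ?thesis by (simp add: bij_betw_same_card)
qed

text \<open>Induction on the order. If it is not a prime power, it is a product of coprime factors
  \<open>s\<close> and \<open>m\<close>, both different from 1; by Bezout \<open>x [^] s\<close> and
  \<open>x [^] m\<close> cannot both lie in \<open>N\<close>, and both have smaller order. The prime
  found need not be the one split off.\<close>

lemma primary_power_exists: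
  assumes "finite (carrier G)" "subgroup N G" "x \<in> carrier G" "x \<notin> N"
  shows "\<exists>(k::nat) q. prime q \<and> q dvd ord x \<and> pi_number {q} (ord (x [^] k)) \<and> x [^] k \<notin> N"
  using assms(3,4)
proof (induction "ord x" arbitrary: x rule: less_induct)
  case less
  have pos: "ord x > 0" using ord_ge_1[OF assms(1)] less by fastforce
  have "x \<noteq> \<one>" using less subgroup.one_closed[OF assms(2)] by auto
  then have "ord x \<noteq> 1" using less ord_eq_1 by blast
  then obtain q where q: "prime q" "q dvd ord x" using prime_factor_nat by blast
  show ?case
  proof (cases "pi_number {q} (ord x)")
    case True
    then show ?thesis using q less.prems by (intro exI[of _ "1::nat"] exI[of _ q]) simp
  next
    case False
    then obtain r where r: "prime r" "r dvd ord x" "r \<noteq> q" by (auto simp: pi_number_def)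
    have "\<not> is_unit q" using q(1) not_prime_unit by blast
    then obtain m where m: "ord x = q ^ multiplicity q (ord x) * m" "\<not> q dvd m"
      using multiplicity_decompose'[of "ord x" q] pos by (metis less_not_refl)
    define s where "s = q ^ multiplicity q (ord x)"
    have sm: "ord x = s * m" using m by (simp add: s_def)
    have "s \<noteq> 1" using sm m(2) q(2) by auto
    have "m \<noteq> 1"
    proof
      assume "m = 1"
      then have "r dvd s" using r(2) sm by simp
      then have "r dvd q" unfolding s_def by (rule prime_dvd_power[OF r(1)])
      then show False using r q primes_dvd_imp_eq by blast
    qed
    have "coprime s m"
      using m q by (simp add: s_def prime_imp_coprime)
    then have "\<exists>l\<in>{s, m}. x [^] l \<notin> N"
      using coprime_pows_mem[OF assms(2) less.prems(1), of s m] less.prems(2) by blast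
    then obtain l where l: "l \<in> {s, m}" "x [^] l \<notin> N" by blast
    have ord_l: "ord (x [^] l) < ord x" "ord (x [^] l) dvd ord x"
      using l(1) sm pos \<open>s \<noteq> 1\<close> \<open>m \<noteq> 1\<close> less.prems(1) by (auto simp: ord_pow)
    then obtain k :: nat and q' where "prime q'" "q' dvd ord (x [^] l)"
      "pi_number {q'} (ord ((x [^] l) [^] k))" "(x [^] l) [^] k \<notin> N"
      using less.hyps[OF ord_l(1)] l(2) less.prems(1) by auto
    then show ?thesis
      using ord_l(2) less.prems(1) by (intro exI[of _ "l * k"] exI[of _ q']) (auto simp: nat_pow_pow)
  qed
qed

lemma centralizer_pow_subset:
  assumes "x \<in> carrier G"
  shows "centralizer G x \<subseteq> centralizer G (x [^] (k::nat))"
proof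
  fix g assume g: "g \<in> centralizer G x"
  then have gc: "g \<in> carrier G" by (simp add: centralizer_def)
  have "conjugate g x = x" using g gc assms by (simp add: centralizer_def conjugate_fixed_iff)
  then have "conjugate g (x [^] k) = x [^] k" using conjugate_pow[OF gc assms] by metis
  then show "g \<in> centralizer G (x [^] k)"
    using gc assms by (simp add: centralizer_def conjugate_fixed_iff)
qed

lemma conjugate_consistent:
  assumes "subgroup K G" "g \<in> K"
  shows "group.conjugate (G\<lparr>carrier := K\<rparr>) g a = conjugate g a"
  using assms by (simp add: group.conjugate_def[OF subgroup_imp_group] conjugate_def)

text \<open>\<open>K\<close> has least cardinality among the subgroups containing a conjugate of
  \<open>y\<close> outside their own q-core; the whole group is one, because of \<open>y\<close>
  itself.\<close>

lemma critical_subgroup_exists: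
  assumes fin: "finite (carrier G)" and q: "prime q"
    and y: "y \<in> carrier G" "pi_number {q} (ord y)" "y \<notin> pi_core {q} G"
  obtains K Y where "subgroup K G" "critical_class (G\<lparr>carrier := K\<rparr>) q Y"
    "Y \<noteq> {}" "Y \<subseteq> (\<lambda>g. conjugate g y) ` carrier G"
proof -
  let ?cl = "(\<lambda>g. conjugate g y) ` carrier G"
  let ?O = "\<lambda>K. pi_core {q} (G\<lparr>carrier := K\<rparr>)"
  define P where "P K \<longleftrightarrow> subgroup K G \<and> \<not> ?cl \<inter> K \<subseteq> ?O K" for K
  have "y \<in> ?cl" using y(1) by (intro image_eqI[of _ _ \<one>]) auto
  then have "P (carrier G)" using y by (auto simp: P_def subgroup_self)
  then obtain K where K: "P K" and min: "\<And>H. P H \<Longrightarrow> card K \<le> card H"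
    using ex_has_least_nat[of P _ card] by blast
  have sK: "subgroup K G" using K by (simp add: P_def)
  interpret K: group "G\<lparr>carrier := K\<rparr>" by (rule subgroup_imp_group[OF sK])
  have Kc: "K \<subseteq> carrier G" by (rule subgroup.subset[OF sK])
  have finK: "finite K" using fin Kc finite_subset by blast
  \<comment> \<open>Conjugates under all of \<open>G\<close> are used, not just under
    \<open>K\<close>, so that the failure of \<open>P\<close> for a proper subgroup of
    \<open>K\<close> is exactly what \<open>Y_proper\<close> needs.\<close>
  define Y where "Y = ?cl \<inter> K - ?O K"
  have "critical_class (G\<lparr>carrier := K\<rparr>) q Y"
  proof (intro critical_class.intro critical_class_axioms.intro K.is_group)
    show "group.conjugate (G\<lparr>carrier := K\<rparr>) g a \<in> Y"
      if g: "g \<in> carrier (G\<lparr>carrier := K\<rparr>)" and a: "a \<in> Y" for g a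
    proof -
      have gK: "g \<in> K" and gc: "g \<in> carrier G" using g Kc by auto
      obtain h where h: "h \<in> carrier G" "a = conjugate h y" using a by (auto simp: Y_def)
      have "conjugate g a = conjugate (g \<otimes> h) y" using h gc y(1) by (simp add: conjugate_mult)
      then have "conjugate g a \<in> ?cl" using h gc by blast
      moreover have "conjugate g a \<in> K"
        using a gK sK by (simp add: Y_def conjugate_def subgroup.m_closed subgroup.m_inv_closed)
      \<comment> \<open>The q-core is normal in \<open>K\<close>, so conjugating back by
        \<open>inv g\<close> would put \<open>a\<close> into it.\<close>
      moreover have "conjugate g a \<notin> ?O K"
      proof
        assume *: "conjugate g a \<in> ?O K"
        have "?O K \<lhd> G\<lparr>carrier := K\<rparr>" using K.pi_core_greatest(1) finK by simp
        then have "K.conjugate (inv g) (conjugate g a) \<in> ?O K"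
          using normal.inv_op_closed2[of "?O K" "G\<lparr>carrier := K\<rparr>" "inv g"] * gK sK
          by (simp add: K.conjugate_def subgroup.m_inv_closed)
        then show False
          using a gK gc sK Kc by (auto simp: Y_def conjugate_consistent subgroup.m_inv_closed)
      qed
      ultimately show ?thesis using conjugate_consistent[OF sK gK] by (simp add: Y_def)
    qed
    show "pi_number {q} (group.ord (G\<lparr>carrier := K\<rparr>) a)" if "a \<in> Y" for a
      using that y by (auto simp: Y_def ord_consistent[OF sK] ord_conjugate)
    show "Y \<inter> H \<subseteq> pi_core {q} (G\<lparr>carrier := K, carrier := H\<rparr>)"
      if H: "subgroup H (G\<lparr>carrier := K\<rparr>)" "H \<noteq> carrier (G\<lparr>carrier := K\<rparr>)" for H
    proof -
      have "H \<subset> K" using subgroup.subset[OF H(1)] H(2) by auto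
      then have "\<not> P H" using min[of H] psubset_card_mono[OF finK \<open>H \<subset> K\<close>] by (meson not_le)
      then have "?cl \<inter> H \<subseteq> ?O H" using incl_subgroup[OF sK H(1)] by (simp add: P_def)
      then show ?thesis by (auto simp: Y_def)
    qed
  qed (use q finK in \<open>auto simp: Y_def\<close>)
  moreover have "Y \<noteq> {}" using K by (auto simp: P_def Y_def)
  ultimately show ?thesis using sK by (intro that[of K Y]) (auto simp: Y_def)
qed

section \<open>Counting pi-elements in the centralizers of generating conjugates\<close>

lemma commute_generate:
  assumes "E \<subseteq> centralizer G g" "g \<in> carrier G" "k \<in> generate G E"
  shows "g \<in> centralizer G k"
  using generate_subgroup_incl[OF assms(1) centralizer_subgroup[OF assms(2)]] assms(2,3)
  by (auto simp: centralizer_def)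

lemma pi_elements_mult:
  assumes "s \<in> pi_elements G \<pi>" "t \<in> pi_elements G \<pi>" "s \<otimes> t = t \<otimes> s"
  shows "s \<otimes> t \<in> pi_elements G \<pi>"
proof -
  have st: "s \<in> carrier G" "t \<in> carrier G" using assms by (auto simp: pi_elements_def)
  have "pi_number \<pi> (ord (s \<otimes> t))"
    by (rule pi_number_dvd[OF pi_number_mult ord_mul_divides[OF assms(3) st]])
      (use assms in \<open>auto simp: pi_elements_def\<close>)
  then show ?thesis using st by (simp add: pi_elements_def)
qed

lemma pi_elements_pow:
  assumes "s \<in> pi_elements G \<pi>"
  shows "s [^] (n::nat) \<in> pi_elements G \<pi>"
proof (induction n)
  case 0 show ?case using ord_id by (simp add: pi_elements_def pi_number_def)
next
  case (Suc n)
  have "s \<in> carrier G" using assms by (simp add: pi_elements_def)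
  then have "s [^] n \<otimes> s = s \<otimes> s [^] n" using nat_pow_Suc2[of s n] by simp
  then show ?case using pi_elements_mult[OF Suc assms] by simp
qed

end

text \<open>The petals \<open>S i - D\<close> are pairwise disjoint and disjoint from the kernel
  \<open>D\<close>. As \<open>D\<close> lies in each \<open>S i\<close>, the truncated difference is
  the true petal size.\<close>

lemma sunflower_card:
  fixes n d :: nat
  assumes "finite T" "finite I" "\<And>i. i \<in> I \<Longrightarrow> S i \<subseteq> T" "D \<subseteq> T"
    and "\<And>i j. \<lbrakk>i \<in> I; j \<in> I; i \<noteq> j\<rbrakk> \<Longrightarrow> S i \<inter> S j \<subseteq> D"
    and "\<And>i. i \<in> I \<Longrightarrow> D \<subseteq> S i" "\<And>i. i \<in> I \<Longrightarrow> card (S i) = n"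
  shows "card I * (n - card D) + card D \<le> card T"
proof -
  have finS: "finite (S i)" if "i \<in> I" for i using assms(1,3) that finite_subset by blast
  have finD: "finite D" using assms(1,4) finite_subset by blast
  have "card (\<Union>i\<in>I. S i - D) = (\<Sum>i\<in>I. card (S i - D))"
  proof (rule card_UN_disjoint)
    show "\<forall>i\<in>I. \<forall>j\<in>I. i \<noteq> j \<longrightarrow> (S i - D) \<inter> (S j - D) = {}" using assms(5) by blast
  qed (use assms(2) finS in auto)
  also have "\<dots> = card I * (n - card D)"
    using assms(6,7) finD by (simp add: card_Diff_subset)
  finally have "card ((\<Union>i\<in>I. S i - D) \<union> D) = card I * (n - card D) + card D"
    by (subst card_Un_disjoint) (use assms(2) finS finD in auto)
  moreover have "(\<Union>i\<in>I. S i - D) \<union> D \<subseteq> T" using assms(3,4) by blast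
  ultimately show ?thesis using card_mono[OF assms(1)] by metis
qed

context group
begin

text \<open>The sunflower bound exceeds \<open>q * n\<close> by \<open>n - q * card D\<close>, read
  as an integer, so it suffices exactly when \<open>q * card D \<le> n\<close>; the translates of
  \<open>D\<close> by powers of \<open>a\<close> provide this second estimate.\<close>

lemma prime_mult_card_pi_centralizer_le:
  assumes fin: "finite (carrier G)" and q: "prime q" "q \<in> \<pi>"
    and y: "y \<in> carrier G" "pi_number {q} (ord y)" "y \<notin> pi_core {q} G"
  shows "q * card (pi_elements G \<pi> \<inter> centralizer G y) \<le> card (pi_elements G \<pi>)"
proof -
  let ?T = "pi_elements G \<pi>"
  let ?C = "\<lambda>a. ?T \<inter> centralizer G a"
  obtain K Y where sK: "subgroup K G" and crit: "critical_class (G\<lparr>carrier := K\<rparr>) q Y"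
    and Y: "Y \<noteq> {}" "Y \<subseteq> (\<lambda>g. conjugate g y) ` carrier G"
    using critical_subgroup_exists[OF fin q(1) y] by metis
  interpret K: critical_class "G\<lparr>carrier := K\<rparr>" q Y by (rule crit)
  have Kc: "K \<subseteq> carrier G" by (rule subgroup.subset[OF sK])
  obtain a b where ab: "a \<in> Y" "b \<in> Y"
    and gen_a: "\<And>i. generate (G\<lparr>carrier := K\<rparr>) {a, K.conjugate (a [^]\<^bsub>G\<lparr>carrier := K\<rparr>\<^esub> (i::nat)) b} = K"
    and gen_b: "\<And>i j. i < j \<Longrightarrow> j < q \<Longrightarrow> generate (G\<lparr>carrier := K\<rparr>)
      {K.conjugate (a [^]\<^bsub>G\<lparr>carrier := K\<rparr>\<^esub> i) b, K.conjugate (a [^]\<^bsub>G\<lparr>carrier := K\<rparr>\<^esub> j) b} = K"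
    and moved: "\<And>i. 0 < i \<Longrightarrow> i < q \<Longrightarrow> K.conjugate (a [^]\<^bsub>G\<lparr>carrier := K\<rparr>\<^esub> (i::nat)) b \<noteq> b"
    using K.generating_conjugates[OF Y(1)] by auto
  have abK: "a \<in> K" "b \<in> K" using ab K.Y_carrier by auto
  then have abc: "a \<in> carrier G" "b \<in> carrier G" using Kc by auto
  have pK: "a [^] (i::nat) \<in> K" for i
    by (induction i) (use abK sK in \<open>auto simp: subgroup.one_closed subgroup.m_closed\<close>)
  have conj: "K.conjugate (a [^]\<^bsub>G\<lparr>carrier := K\<rparr>\<^esub> (i::nat)) b = conjugate (a [^] i) b" for i
    using conjugate_consistent[OF sK pK] by (simp flip: nat_pow_consistent)
  have cK: "conjugate (a [^] (i::nat)) b \<in> K" for i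
    using pK abK sK by (simp add: conjugate_def subgroup.m_closed subgroup.m_inv_closed)
  have gen: "generate (G\<lparr>carrier := K\<rparr>) {u, v} = generate G {u, v}" if "u \<in> K" "v \<in> K" for u v
    using generate_consistent[OF _ sK, of "{u, v}"] that by simp
  \<comment> \<open>The index \<open>q\<close> is reserved for \<open>a\<close>, so
    \<open>{..q}\<close> indexes all \<open>q + 1\<close> elements.\<close>
  define c where "c i = (if i < q then conjugate (a [^] i) b else a)" for i :: nat
  have c: "c i \<in> K" for i using cK abK by (simp add: c_def)
  have gen_c: "generate G {c i, c j} = K" if "i < j" "j \<le> q" for i j
    using gen_a[of i] gen_b[of i j] that cK abK by (auto simp: c_def conj gen insert_commute)
  define D where "D = ?T \<inter> {g. \<forall>k\<in>K. g \<in> centralizer G k}"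
  have CD_less: "?C (c i) \<inter> ?C (c j) \<subseteq> D" if ij: "i < j" "j \<le> q" for i j
  proof
    fix g assume g: "g \<in> ?C (c i) \<inter> ?C (c j)"
    \<comment> \<open>Commuting is symmetric: the centralizer of \<open>g\<close> contains two
      generators of \<open>K\<close> and hence all of \<open>K\<close>.\<close>
    have "{c i, c j} \<subseteq> centralizer G g" using g c Kc by (auto simp: centralizer_def)
    then show "g \<in> D"
      using commute_generate[of "{c i, c j}" g] gen_c[OF ij] g by (auto simp: D_def pi_elements_def)
  qed
  have CD: "?C (c i) \<inter> ?C (c j) \<subseteq> D" if "i \<in> {..q}" "j \<in> {..q}" "i \<noteq> j" for i j
    using CD_less[of i j] CD_less[of j i] that by (cases "i < j") auto
  have DC: "D \<subseteq> ?C k" if "k \<in> K" for k using that by (auto simp: D_def)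
  have finT: "finite ?T" using fin by (simp add: pi_elements_def)
  define n where "n = card (?C y)"
  have cardY: "card (?C w) = n" if "w \<in> Y" for w
    using Y(2) that card_pi_centralizer_conjugate[OF _ y(1)] by (auto simp: n_def)
  have cardC: "card (?C (c i)) = n" for i
    using cardY[OF ab(1)] cardY[OF ab(2)] card_pi_centralizer_conjugate[of "a [^] i" b] abc
    by (simp add: c_def)
  have "card {..q} * (n - card D) + card D \<le> card ?T"
    by (rule sunflower_card[where S = "\<lambda>i. ?C (c i)"])
      (use finT CD DC c cardC in \<open>auto simp: D_def\<close>)
  moreover have "q * card D \<le> n"
  proof -
    obtain g where "g \<in> carrier G" "a = conjugate g y" using ab(1) Y(2) by blast
    then have "pi_number {q} (ord a)" using y by (simp add: ord_conjugate)
    then have aT: "a \<in> ?T" using abc(1) q(2) by (auto simp: pi_elements_def pi_number_def)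
    have dC: "d \<in> ?T" "d \<in> carrier G" "d \<otimes> a [^] i = a [^] i \<otimes> d" "d \<in> centralizer G b"
      if "d \<in> D" for d and i :: nat
      using that pK abK by (auto simp: D_def centralizer_def)
    let ?f = "\<lambda>(i, d). a [^] (i::nat) \<otimes> d"
    \<comment> \<open>A collision makes a power of \<open>a\<close> with exponent strictly between 0
      and \<open>q\<close> equal to \<open>d \<otimes> inv e\<close>, which centralizes
      \<open>b\<close> because \<open>D\<close> centralizes \<open>K\<close>; this contradicts
      \<open>moved\<close>.\<close>
    have no_coll: False if "i < j" "j < q" "d \<in> D" "e \<in> D" "a [^] i \<otimes> d = a [^] j \<otimes> e" for i j d e
    proof -
      define k where "k = j - i"
      have k: "0 < k" "k < q" "j = i + k" using that by (auto simp: k_def)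
      have "a [^] i \<otimes> d = a [^] i \<otimes> (a [^] k \<otimes> e)"
        using that(5) k(3) abc dC(2)[OF that(4)] by (simp add: m_assoc flip: nat_pow_mult)
      then have "d = a [^] k \<otimes> e" using abc dC(2) that by simp
      then have "a [^] k = d \<otimes> inv e" using abc dC(2) that by (simp add: m_assoc)
      then have "a [^] k \<in> centralizer G b"
        using dC(4) that centralizer_subgroup[OF abc(2)]
        by (simp add: subgroup.m_closed subgroup.m_inv_closed)
      then have "conjugate (a [^] k) b = b" using abc by (simp add: conjugate_fixed_iff centralizer_def)
      then show False using moved[OF k(1,2)] conj by simp
    qed
    have "inj_on ?f ({..<q} \<times> D)"
    proof (rule inj_onI)
      fix u v assume uv: "u \<in> {..<q} \<times> D" "v \<in> {..<q} \<times> D" "?f u = ?f v"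
      obtain i d j e where ij: "u = (i, d)" "v = (j, e)" by fastforce
      have "i = j"
        using no_coll[of i j d e] no_coll[of j i e d] uv ij by (cases i j rule: linorder_cases) auto
      then show "u = v" using uv ij abc dC(2) by auto
    qed
    moreover have "?f ` ({..<q} \<times> D) \<subseteq> ?C a"
    proof clarify
      fix i :: nat and d assume d: "d \<in> D"
      have "a [^] i \<otimes> d \<in> ?T"
        by (rule pi_elements_mult[OF pi_elements_pow[OF aT] dC(1)[OF d] dC(3)[OF d, symmetric]])
      moreover have "a [^] i \<in> centralizer G a"
        using nat_pow_Suc2[OF abc(1), of i] abc by (simp add: centralizer_def)
      moreover have "d \<in> centralizer G a" using DC[OF abK(1)] d by blast
      ultimately show "a [^] i \<otimes> d \<in> ?C a"
        using centralizer_subgroup[OF abc(1)] by (simp add: subgroup.m_closed)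
    qed
    moreover have "finite (?C a)" using finT by simp
    ultimately have "card ({..<q} \<times> D) \<le> card (?C a)" by (rule card_inj_on_le)
    then show ?thesis using cardY[OF ab(1)] by (simp add: card_cartesian_product)
  qed
  moreover have "card D \<le> n"
    using card_mono[of "?C a" D] DC[OF abK(1)] cardY[OF ab(1)] finT by simp
  \<comment> \<open>Writing \<open>n = e + d\<close> removes the truncated subtraction and reduces
    the claim to \<open>q * d \<le> e + d\<close>.\<close>
  moreover have "q * n \<le> (q + 1) * (n - d) + d" if d: "q * d \<le> n" "d \<le> n" for d
  proof -
    obtain e where "n = e + d" using d(2) by (metis le_add_diff_inverse2)
    then show ?thesis using d(1) by (simp add: algebra_simps)
  qed
  ultimately have "q * n \<le> card ?T"
    by (metis Suc_eq_plus1 card_atMost order_trans)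
  then show ?thesis by (simp add: n_def)
qed

end

section \<open>From elements of prime power order to all pi-elements\<close>

theorem theoremA:
  fixes G :: "('a, 'b) monoid_scheme" and \<pi> :: "nat set" and p :: nat and x :: 'a
  assumes "group G" and "finite (carrier G)"
    and "\<forall>q\<in>\<pi>. prime q"
    and "p \<in> \<pi>" and "\<forall>q\<in>\<pi>. p \<le> q"
    and "x \<in> pi_elements G \<pi> - pi_core \<pi> G"
  shows "real (card (pi_elements (G\<lparr>carrier := centralizer G x\<rparr>) \<pi>)) / real (card (pi_elements G \<pi>))
           \<le> 1 / real p"
proof -
  interpret group G by (rule assms(1))
  let ?T = "pi_elements G \<pi>"
  note fin = assms(2)
  have x: "x \<in> carrier G" "pi_number \<pi> (ord x)" "x \<notin> pi_core \<pi> G"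
    using assms(6) by (auto simp: pi_elements_def)
  obtain k :: nat and q where q: "prime q" "q dvd ord x" "pi_number {q} (ord (x [^]\<^bsub>G\<^esub> k))"
      "x [^]\<^bsub>G\<^esub> k \<notin> pi_core \<pi> G"
    using primary_power_exists[OF fin normal_imp_subgroup[OF pi_core_greatest(1)[OF fin]] x(1,3)] by blast
  have q\<pi>: "q \<in> \<pi>" using q x(2) by (simp add: pi_number_def)
  \<comment> \<open>As \<open>q\<close> lies in \<pi>, the q-core is a normal \<pi>-subgroup and
    hence part of the \<pi>-core, so the chosen power of \<open>x\<close> avoids it as well.\<close>
  have "pi_subgroup (pi_core {q} G) \<pi> G"
    using pi_core_greatest(2)[OF fin, of "{q}"] q\<pi> by (auto simp: pi_subgroup_def pi_number_def)
  then have "pi_core {q} G \<subseteq> pi_core \<pi> G"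
    using pi_core_greatest(1,3)[OF fin] by blast
  then have "x [^]\<^bsub>G\<^esub> k \<notin> pi_core {q} G" using q(4) by blast
  then have "q * card (?T \<inter> centralizer G (x [^]\<^bsub>G\<^esub> k)) \<le> card ?T"
    using prime_mult_card_pi_centralizer_le[OF fin q(1) q\<pi> _ q(3)] x(1) by simp
  moreover have "card (?T \<inter> centralizer G x) \<le> card (?T \<inter> centralizer G (x [^]\<^bsub>G\<^esub> k))"
    using centralizer_pow_subset[OF x(1), of k] fin
    by (intro card_mono) (auto simp: pi_elements_def)
  moreover have "p \<le> q" using assms(5) q\<pi> by blast
  ultimately have "p * card (?T \<inter> centralizer G x) \<le> card ?T"
    by (meson mult_le_mono order_trans)
  then have "real p * real (card (?T \<inter> centralizer G x)) \<le> real (card ?T)"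
    by (simp flip: of_nat_mult)
  \<comment> \<open>\<open>x\<close> itself is a \<pi>-element, so the denominator of the quotient
    is not zero.\<close>
  moreover have "card ?T > 0"
    using assms(6) fin by (auto simp: card_gt_0_iff pi_elements_def)
  moreover have "p > 0" using assms(3,4) prime_gt_0_nat by blast
  ultimately show ?thesis
    by (simp add: pi_elements_centralizer[OF x(1)] field_simps)
qed

end
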